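(* Let $d\ge 1$ be an integer, $\alpha\in\mathbb{B}^{d+2}$, let $\tau:\{1,\dots,d\}\to\{1,\dots,d\}$ be a bijection, let $\lambda\in[0,1)\setminus\mathbb{Q}$, let $-\lambda<\eta=p-q\lambda<1$ for some $p,q\in\mathbb{N}\setminus\{0\}$, and set $\kappa=(\alpha,\tau,\lambda,\eta,1)$. Let $(m_0,n_0)$ be the largest element of $\mathcal{N}_\lambda^<$ (ordered by $w_\lambda$) such that $P_{m_0,n_0}<p$ or $Q_{m_0,n_0}<q$. Then for all $(m,n)\in\mathcal{N}_\lambda^<$ with $w_\lambda(m,n)>w_\lambda(m_0,n_0)$, the first return time $h$ is constant on $E^{-1}(S_{m,n}(\lambda))$ with value $h_{m,n+1}$. Moreover, for every $z\in E^{-1}(S_{m,n}(\lambda))$, $$R_\kappa(z)=E(z)+\Delta_{m,n+1}(\lambda).$$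
   Context: $\mathbb{N}=\{0,1,2,\dots\}$. Let $\overline{\mathbb{H}}=\{z\in\mathbb{C}:\operatorname{Im} z\ge 0\}$ and $\mathbb{H}=\{z\in\mathbb{C}:\operatorname{Im} z>0\}$. For an integer $d\ge1$, $\mathbb{B}^{d+2}=\{(\alpha_0,\dots,\alpha_{d+1})\in(0,\pi)^{d+2}:\sum_{j=0}^{d+1}\alpha_j=\pi\}$. Given $\alpha\in\mathbb{B}^{d+2}$, let $W_0=[0,\alpha_0)$, $W_1=[\alpha_0,\alpha_0+\alpha_1]$ and $W_j=\big(\sum_{k=0}^{j-1}\alpha_k,\sum_{k=0}^{j}\alpha_k\big]$ for $2\le j\le d+1$. Let $C_1=\{0\}\cup\{z\in\mathbb{H}:\operatorname{Arg}z\in W_1\}$ and, for $j\ne1$, $C_j=\{z\in\overline{\mathbb{H}}\setminus\{0\}:\operatorname{Arg}z\in W_j\}$. The middle cone is $C_c=\bigcup_{j=1}^dC_j$. For a set $A\subset\mathbb{C}$ and $x\in\mathbb{R}$, $A-x=\{a-x:a\in A\}$. Given a bijection $\tau$ of $\{1,\dots,d\}$, let $\theta_j=\sum_{\tau(k)<\tau(j)}\alpha_k-\sum_{k<j}\alpha_k$ for $1\le j\le d$, where $k$ ranges over $\{1,\dots,d\}$ in both sums. Define $E:\overline{\mathbb{H}}\to\overline{\mathbb{H}}$ by $E(z)=z$ if $z\in C_0\cup C_{d+1}$ and $E(z)=ze^{i\theta_j}$ if $z\in C_j$, $1\le j\le d$. Given real $\lambda,\rho>0$ with $\lambda/\rho\notin\mathbb{Q}$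 and $-\lambda<\eta<\rho$, define $G(z)=z+\lambda$ if $z\in C_{d+1}$, $G(z)=z-\eta$ if $z\in C_c$, $G(z)=z-\rho$ if $z\in C_0$. For $\kappa=(\alpha,\tau,\lambda,\eta,\rho)$, put $F_\kappa=G\circ E:\overline{\mathbb{H}}\to\overline{\mathbb{H}}$. For $z\in C_c$, the first return time is $h(z)=\inf\{n>0:F_\kappa^n(z)\in C_c\}$ and the first return map is $R_\kappa(z)=F_\kappa^{h(z)}(z)$ (defined when $h(z)<\infty$). Continued fractions: for irrational $\lambda=[0;\lambda_1,\lambda_2,\dots]\in(0,1)$, $p_{-1}=1,q_{-1}=0,p_0=0,q_0=1$, $p_m=\lambda_mp_{m-1}+p_{m-2}$, $q_m=\lambda_mq_{m-1}+q_{m-2}$ for $m\ge1$. Let $\mathcal{N}_\lambda=\{(m,n)\in\mathbb{N}^2:0\le n\le\lambda_{m+1}\}$ and $\mathcal{N}_\lambda^<=\{(m,n)\in\mathbb{N}^2:0\le n<\lambda_{m+1}\}$, and let $w_\lambda(m,n)=\lambda_1+\dots+\lambda_m+n$ (so $w_\lambda(0,n)=n$); $w_\lambda$ is a bijection from $\mathcal{N}_\lambda^<$ onto $\mathbb{N}$ and "largest" in $\mathcal{N}_\lambda^<$ refers to the order induced by $w_\lambda$. For $(m,n)\in\mathcal{N}_\lambda$ let $P_{m,0}=p_m$, $Q_{m,0}=q_m$ and, for $n\ge1$, $P_{m,n}=np_m+p_{m-1}$, $Q_{m,n}=nq_m+q_{m-1}$. Let $\Delta_{m,n}=\Delta_{m,n}(\lambda)=Q_{m,n}\lambda-P_{m,n}$,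 and $\Delta_{-1,0}=-1$. Given $\eta=p-q\lambda$, let $h_{m,n}=(Q_{m,n}-q)+(P_{m,n}-p)+1$. For $(m,n)\in\mathcal{N}_\lambda^<$ define: if $m$ is even, $$S_{m,n}(\lambda)=(C_0-\Delta_{m,0})\cap C_c\cap(C_c-\Delta_{m,n+1})\cap\big(C_{d+1}-(n\Delta_{m,0}+\Delta_{m-1,0})\big);$$ if $m$ is odd, $$S_{m,n}(\lambda)=\big(C_0-(n\Delta_{m,0}+\Delta_{m-1,0})\big)\cap C_c\cap(C_c-\Delta_{m,n+1})\cap(C_{d+1}-\Delta_{m,0}).$$ *)

theory Defs
  imports Complex_Main "HOL-Library.Extended_Nat"
begin

definition upper_half :: "complex set" where
  "upper_half = {z. Im z > 0}"

definition closed_upper_half :: "complex set" where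
  "closed_upper_half = {z. Im z \<ge> 0}"

text \<open>A tuple \<open>(\<alpha>\<^sub>0, \<dots>, \<alpha>\<^sub>d\<^sub>+\<^sub>1)\<close> is a function on \<open>nat\<close> of which only the
  values at \<open>0, \<dots>, d + 1\<close> are used.\<close>

definition angle_tuples :: "nat \<Rightarrow> (nat \<Rightarrow> real) set" where
  "angle_tuples d = {\<alpha>. (\<forall>j\<le>d + 1. 0 < \<alpha> j \<and> \<alpha> j < pi) \<and> (\<Sum>j\<le>d + 1. \<alpha> j) = pi}"

definition sector :: "(nat \<Rightarrow> real) \<Rightarrow> nat \<Rightarrow> real set" where
  "sector \<alpha> j =
    (if j = 0 then {0..<\<alpha> 0}
     else if j = 1 then {\<alpha> 0..\<alpha> 0 + \<alpha> 1}
     else {(\<Sum>k<j. \<alpha> k)<..(\<Sum>k\<le>j. \<alpha> k)})"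

definition cone :: "(nat \<Rightarrow> real) \<Rightarrow> nat \<Rightarrow> complex set" where
  "cone \<alpha> j =
    (if j = 1 then {0} \<union> {z \<in> upper_half. Arg z \<in> sector \<alpha> 1}
     else {z \<in> closed_upper_half - {0}. Arg z \<in> sector \<alpha> j})"

definition middle_cone :: "nat \<Rightarrow> (nat \<Rightarrow> real) \<Rightarrow> complex set" where
  "middle_cone d \<alpha> = (\<Union>j\<in>{1..d}. cone \<alpha> j)"

definition shift :: "complex set \<Rightarrow> real \<Rightarrow> complex set" where
  "shift A x = (\<lambda>a. a - complex_of_real x) ` A"

definition rot_angle :: "nat \<Rightarrow> (nat \<Rightarrow> real) \<Rightarrow> (nat \<Rightarrow> nat) \<Rightarrow> nat \<Rightarrow> real" where
  "rot_angle d \<alpha> \<tau> j =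
    (\<Sum>k\<in>{k \<in> {1..d}. \<tau> k < \<tau> j}. \<alpha> k) - (\<Sum>k\<in>{k \<in> {1..d}. k < j}. \<alpha> k)"

text \<open>For \<open>\<alpha> \<in> angle_tuples d\<close> the cones \<open>cone \<alpha> 0, \<dots>, cone \<alpha> (d + 1)\<close> partition the closed
  upper half-plane, so the index \<open>j\<close> below is unique. The maps \<open>cone_exchange\<close> and
  \<open>cone_translation\<close> are only meaningful on \<open>closed_upper_half\<close>; their values elsewhere are
  irrelevant.\<close>

definition cone_exchange ::
    "nat \<Rightarrow> (nat \<Rightarrow> real) \<Rightarrow> (nat \<Rightarrow> nat) \<Rightarrow> complex \<Rightarrow> complex" where
  "cone_exchange d \<alpha> \<tau> z =
    (if z \<in> middle_cone d \<alpha>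
     then z * cis (rot_angle d \<alpha> \<tau> (THE j. j \<in> {1..d} \<and> z \<in> cone \<alpha> j))
     else z)"

definition cone_translation ::
    "nat \<Rightarrow> (nat \<Rightarrow> real) \<Rightarrow> real \<Rightarrow> real \<Rightarrow> real \<Rightarrow> complex \<Rightarrow> complex" where
  "cone_translation d \<alpha> lam \<eta> \<rho> z =
    (if z \<in> cone \<alpha> (d + 1) then z + complex_of_real lam
     else if z \<in> middle_cone d \<alpha> then z - complex_of_real \<eta>
     else z - complex_of_real \<rho>)"

definition tce ::
    "nat \<Rightarrow> (nat \<Rightarrow> real) \<Rightarrow> (nat \<Rightarrow> nat) \<Rightarrow> real \<Rightarrow> real \<Rightarrow> real \<Rightarrow> complex \<Rightarrow> complex" where
  "tce d \<alpha> \<tau> lam \<eta> \<rho> = cone_translation d \<alpha> lam \<eta> \<rho> \<circ> cone_exchange d \<alpha> \<tau>"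

text \<open>The infimum is taken in \<open>enat\<close>, so that it is \<open>\<infinity>\<close> for points that never return.
  The return time is meant for \<open>z \<in> middle_cone d \<alpha>\<close>, and the return map moreover
  for finite return time.\<close>

definition return_time ::
    "nat \<Rightarrow> (nat \<Rightarrow> real) \<Rightarrow> (nat \<Rightarrow> nat) \<Rightarrow> real \<Rightarrow> real \<Rightarrow> real \<Rightarrow> complex \<Rightarrow> enat" where
  "return_time d \<alpha> \<tau> lam \<eta> \<rho> z =
    Inf {enat n |n. n > 0 \<and> (tce d \<alpha> \<tau> lam \<eta> \<rho> ^^ n) z \<in> middle_cone d \<alpha>}"

definition return_map ::
    "nat \<Rightarrow> (nat \<Rightarrow> real) \<Rightarrow> (nat \<Rightarrow> nat) \<Rightarrow> real \<Rightarrow> real \<Rightarrow> real \<Rightarrow> complex \<Rightarrow> complex" where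
  "return_map d \<alpha> \<tau> lam \<eta> \<rho> z =
    (tce d \<alpha> \<tau> lam \<eta> \<rho> ^^ the_enat (return_time d \<alpha> \<tau> lam \<eta> \<rho> z)) z"

text \<open>The expansion \<open>lam = [0; cf_digit lam 1, cf_digit lam 2, \<dots>]\<close> of an irrational \<open>lam\<close> in
  \<open>(0, 1)\<close>, by iteration of the Gauss map.\<close>

primrec cf_rem :: "real \<Rightarrow> nat \<Rightarrow> real" where
  "cf_rem lam 0 = lam"
| "cf_rem lam (Suc m) = frac (1 / cf_rem lam m)"

primrec cf_digit :: "real \<Rightarrow> nat \<Rightarrow> nat" where
  "cf_digit lam 0 = 0"
| "cf_digit lam (Suc m) = nat \<lfloor>1 / cf_rem lam m\<rfloor>"

lemma cf_rem_bounds: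
  assumes "0 < lam" "lam < 1" "lam \<notin> \<rat>"
  shows "0 < cf_rem lam m \<and> cf_rem lam m < 1 \<and> cf_rem lam m \<notin> \<rat>"
proof (induction m)
  case 0
  then show ?case using assms by simp
next
  case (Suc m)
  have irr: "1 / cf_rem lam m \<notin> \<rat>"
  proof
    assume "1 / cf_rem lam m \<in> \<rat>"
    then have "1 / (1 / cf_rem lam m) \<in> \<rat>" by (rule Rats_divide[OF Rats_1])
    then show False using Suc by simp
  qed
  have irr': "frac (1 / cf_rem lam m) \<notin> \<rat>"
  proof
    assume "frac (1 / cf_rem lam m) \<in> \<rat>"
    then have "frac (1 / cf_rem lam m) + of_int \<lfloor>1 / cf_rem lam m\<rfloor> \<in> \<rat>"
      by (intro Rats_add) auto
    then show False using irr by (simp add: frac_def)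
  qed
  then have "frac (1 / cf_rem lam m) \<noteq> 0" by (metis Rats_0)
  then have "0 < frac (1 / cf_rem lam m)"
    using frac_ge_0[of "1 / cf_rem lam m"] by linarith
  then show ?case using irr' frac_lt_1 by simp
qed

lemma cf_rem_step:
  assumes "0 < lam" "lam < 1" "lam \<notin> \<rat>"
  shows "cf_digit lam (Suc m) \<ge> 1"
    and "cf_rem lam m = 1 / (real (cf_digit lam (Suc m)) + cf_rem lam (Suc m))"
proof -
  have r: "0 < cf_rem lam m" "cf_rem lam m < 1"
    using cf_rem_bounds[OF assms] by auto
  then have "1 \<le> 1 / cf_rem lam m" by simp
  then have fl: "1 \<le> \<lfloor>1 / cf_rem lam m\<rfloor>" by (simp add: le_floor_iff)
  then show "cf_digit lam (Suc m) \<ge> 1"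
    using nat_mono[OF fl] by simp
  show "cf_rem lam m = 1 / (real (cf_digit lam (Suc m)) + cf_rem lam (Suc m))"
    using fl r by (simp add: frac_def)
qed

text \<open>Numerators and denominators of the convergents with the index shifted by one, so that
  it starts at \<open>-1\<close>: \<open>cf_num lam k\<close> is \<open>p\<^sub>k\<^sub>-\<^sub>1\<close> and \<open>cf_den lam k\<close> is \<open>q\<^sub>k\<^sub>-\<^sub>1\<close>.\<close>

fun cf_num :: "real \<Rightarrow> nat \<Rightarrow> nat" where
  "cf_num lam 0 = 1"
| "cf_num lam (Suc 0) = 0"
| "cf_num lam (Suc (Suc m)) = cf_digit lam (Suc m) * cf_num lam (Suc m) + cf_num lam m"

fun cf_den :: "real \<Rightarrow> nat \<Rightarrow> nat" where
  "cf_den lam 0 = 0"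
| "cf_den lam (Suc 0) = 1"
| "cf_den lam (Suc (Suc m)) = cf_digit lam (Suc m) * cf_den lam (Suc m) + cf_den lam m"

definition index_set :: "real \<Rightarrow> (nat \<times> nat) set" where
  "index_set lam = {(m, n). n < cf_digit lam (m + 1)}"

definition index_weight :: "real \<Rightarrow> nat \<Rightarrow> nat \<Rightarrow> nat" where
  "index_weight lam m n = (\<Sum>i=1..m. cf_digit lam i) + n"

definition semi_num :: "real \<Rightarrow> nat \<Rightarrow> nat \<Rightarrow> nat" where
  "semi_num lam m n =
    (if n = 0 then cf_num lam (m + 1) else n * cf_num lam (m + 1) + cf_num lam m)"

definition semi_den :: "real \<Rightarrow> nat \<Rightarrow> nat \<Rightarrow> nat" where
  "semi_den lam m n =
    (if n = 0 then cf_den lam (m + 1) else n * cf_den lam (m + 1) + cf_den lam m)"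

definition semi_err :: "real \<Rightarrow> nat \<Rightarrow> nat \<Rightarrow> real" where
  "semi_err lam m n = real (semi_den lam m n) * lam - real (semi_num lam m n)"

text \<open>\<open>\<Delta>\<^sub>m\<^sub>-\<^sub>1\<^sub>,\<^sub>0\<close>, with the convention \<open>\<Delta>\<^sub>-\<^sub>1\<^sub>,\<^sub>0 = -1\<close>.\<close>

definition prev_err :: "real \<Rightarrow> nat \<Rightarrow> real" where
  "prev_err lam m = (if m = 0 then -1 else semi_err lam (m - 1) 0)"

definition return_value :: "real \<Rightarrow> nat \<Rightarrow> nat \<Rightarrow> nat \<Rightarrow> nat \<Rightarrow> int" where
  "return_value lam p q m n =
    (int (semi_den lam m n) - int q) + (int (semi_num lam m n) - int p) + 1"

definition return_set :: "nat \<Rightarrow> (nat \<Rightarrow> real) \<Rightarrow> real \<Rightarrow> nat \<Rightarrow> nat \<Rightarrow> complex set" where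
  "return_set d \<alpha> lam m n =
    (if even m then
       shift (cone \<alpha> 0) (semi_err lam m 0) \<inter> middle_cone d \<alpha>
       \<inter> shift (middle_cone d \<alpha>) (semi_err lam m (n + 1))
       \<inter> shift (cone \<alpha> (d + 1)) (real n * semi_err lam m 0 + prev_err lam m)
     else
       shift (cone \<alpha> 0) (real n * semi_err lam m 0 + prev_err lam m) \<inter> middle_cone d \<alpha>
       \<inter> shift (middle_cone d \<alpha>) (semi_err lam m (n + 1))
       \<inter> shift (cone \<alpha> (d + 1)) (semi_err lam m 0))"

end

theory Submission
  imports Defs
begin

text \<open>
  Let \<open>w = E(z)\<close> lie in the return set. The first step of \<open>F\<close> moves \<open>w\<close> to
  \<open>w - \<eta> = w + q \<lambda> - p\<close>. Off the middle cone \<open>E\<close> is the identity, so until the orbit comes back it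
  only moves horizontally: by \<open>\<lambda>\<close> in the left cone \<open>C\<^sub>d\<^sub>+\<^sub>1\<close> and by \<open>-1\<close> in the right cone \<open>C\<^sub>0\<close>.
  The orbit is therefore \<open>w + Q \<lambda> - P\<close> for a lattice path \<open>(Q, P)\<close> that starts at \<open>(q, p)\<close> and
  increases one coordinate by one at each step. The claim is that this path first meets the middle
  cone at \<open>(Q\<^sub>m\<^sub>,\<^sub>n\<^sub>+\<^sub>1, P\<^sub>m\<^sub>,\<^sub>n\<^sub>+\<^sub>1)\<close>;
  its number of steps is then \<open>(Q\<^sub>m\<^sub>,\<^sub>n\<^sub>+\<^sub>1 - q) + (P\<^sub>m\<^sub>,\<^sub>n\<^sub>+\<^sub>1 - p)\<close>, and together with the first step from \<open>z\<close>
  this gives \<open>h\<^sub>m\<^sub>,\<^sub>n\<^sub>+\<^sub>1\<close>.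

  This end point is \<open>u + v\<close>, where \<open>u\<close> and \<open>v\<close> are the vectors \<open>(q\<^sub>m, p\<^sub>m)\<close> and
  \<open>(n q\<^sub>m + q\<^sub>m\<^sub>-\<^sub>1, n p\<^sub>m + p\<^sub>m\<^sub>-\<^sub>1)\<close>, in the order such that the definition of the return set says that
  the displacement of \<open>u\<close> takes \<open>w\<close> into \<open>C\<^sub>0\<close> and that of \<open>v\<close> takes it into \<open>C\<^sub>d\<^sub>+\<^sub>1\<close>; the two parities
  of \<open>m\<close> differ only in this order. The vectors have nonnegative entries and determinant \<open>\<plusminus>1\<close>, so
  every lattice point is \<open>i u + j v\<close> with integers \<open>i, j\<close>. Inside the box from \<open>0\<close> to \<open>u + v\<close> the
  coefficients cannot both be positive, except at \<open>u + v\<close>, nor both nonpositive, except at \<open>0\<close>.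
  In the remaining cases the displacement is at least that of \<open>u\<close> or at most that of \<open>v\<close>, and hence
  takes \<open>w\<close> into one of the outer cones (\<open>box_point_outside\<close>). As \<open>u + v\<close> takes \<open>w\<close> back to the middle
  cone, the path cannot leave the box: on the right side of the box the point is right of a point of
  the middle cone, hence in \<open>C\<^sub>0\<close>, and the next step is upwards; likewise on the upper side
  (\<open>corridor_walk\<close>). The choice of \<open>(m\<^sub>0, n\<^sub>0)\<close> puts \<open>(q, p)\<close> into the box.
\<close>

section \<open>Outer cones and horizontal translations\<close>

lemma sin_neg_iff_of_bounds:
  fixes x :: real
  assumes "- pi < x" "x < pi"
  shows "sin x < 0 \<longleftrightarrow> x < 0"
  using assms sin_gt_zero[of x] sin_gt_zero[of "- x"] by (cases x "0::real" rule: linorder_cases) auto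

lemma Arg_nonneg:
  assumes "Im z \<ge> 0"
  shows "0 \<le> Arg z"
proof (rule ccontr)
  assume "\<not> 0 \<le> Arg z"
  then have "0 < - Arg z" "- Arg z < pi" "z \<noteq> 0"
    using Arg_bounded[of z] by (auto simp: Arg_zero)
  then have "sin (- Arg z) > 0" by (intro sin_gt_zero)
  moreover have "Im z = cmod z * sin (Arg z)"
    using rcis_cmod_Arg[of z] by (metis Im_rcis)
  ultimately have "Im z < 0" using \<open>z \<noteq> 0\<close> by (simp add: mult_pos_neg)
  then show False using assms by simp
qed

text \<open>Comparing the argument with a fixed angle is a linear condition on the point, because
  \<open>Im z cos \<beta> - Re z sin \<beta> = \<bar>z\<bar> sin (Arg z - \<beta>)\<close>. This makes the effect of a horizontal
  translation visible, on the real axis as well.\<close>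

lemma Arg_compare_linear:
  assumes "Im z \<ge> 0" "z \<noteq> 0" "0 < \<beta>" "\<beta> < pi"
  shows "Arg z < \<beta> \<longleftrightarrow> Im z * cos \<beta> < Re z * sin \<beta>"
    and "\<beta> < Arg z \<longleftrightarrow> Re z * sin \<beta> < Im z * cos \<beta>"
proof -
  have z: "z = rcis (cmod z) (Arg z)"
    by (simp add: rcis_cmod_Arg)
  have pos: "cmod z > 0" using assms by simp
  have re: "Re z = cmod z * cos (Arg z)" and im: "Im z = cmod z * sin (Arg z)"
    by (subst z, simp)+
  have bd: "0 \<le> Arg z" "Arg z \<le> pi"
    using Arg_nonneg[OF assms(1)] Arg_bounded by blast+
  have key: "Im z * cos \<beta> - Re z * sin \<beta> = cmod z * sin (Arg z - \<beta>)"
    unfolding re im by (simp add: sin_diff algebra_simps)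
  show "Arg z < \<beta> \<longleftrightarrow> Im z * cos \<beta> < Re z * sin \<beta>"
  proof -
    have "Im z * cos \<beta> < Re z * sin \<beta> \<longleftrightarrow> cmod z * sin (Arg z - \<beta>) < 0"
      unfolding key[symmetric] by simp
    also have "\<dots> \<longleftrightarrow> sin (Arg z - \<beta>) < 0" using pos by (simp add: mult_less_0_iff)
    also have "\<dots> \<longleftrightarrow> Arg z - \<beta> < 0" by (rule sin_neg_iff_of_bounds) (use bd assms in auto)
    finally show ?thesis by auto
  qed
  show "\<beta> < Arg z \<longleftrightarrow> Re z * sin \<beta> < Im z * cos \<beta>"
  proof -
    have "Re z * sin \<beta> < Im z * cos \<beta> \<longleftrightarrow> 0 < cmod z * sin (Arg z - \<beta>)"
      unfolding key[symmetric] by simp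
    also have "\<dots> \<longleftrightarrow> sin (\<beta> - Arg z) < 0"
      using pos sin_minus[of "Arg z - \<beta>"] by (simp add: zero_less_mult_iff)
    also have "\<dots> \<longleftrightarrow> \<beta> - Arg z < 0" by (rule sin_neg_iff_of_bounds) (use bd assms in auto)
    finally show ?thesis by auto
  qed
qed

lemma angle_partial_sums:
  assumes "\<alpha> \<in> angle_tuples d"
  shows "0 < \<alpha> 0" and "\<alpha> 0 < pi"
    and "i \<le> j \<Longrightarrow> j \<le> d + 1 \<Longrightarrow> (\<Sum>k\<le>i. \<alpha> k) \<le> (\<Sum>k\<le>j. \<alpha> k)"
    and "0 < (\<Sum>k\<le>d. \<alpha> k)" and "(\<Sum>k\<le>d. \<alpha> k) < pi"
proof -
  have pos: "\<And>j. j \<le> d + 1 \<Longrightarrow> 0 < \<alpha> j \<and> \<alpha> j < pi" and total: "(\<Sum>j\<le>d + 1. \<alpha> j) = pi"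
    using assms by (auto simp: angle_tuples_def)
  show "0 < \<alpha> 0" "\<alpha> 0 < pi" using pos[of 0] by auto
  show "(\<Sum>k\<le>i. \<alpha> k) \<le> (\<Sum>k\<le>j. \<alpha> k)" if "i \<le> j" "j \<le> d + 1"
  proof (rule sum_mono2)
    show "0 \<le> \<alpha> k" if "k \<in> {..j} - {..i}" for k
      using that \<open>j \<le> d + 1\<close> pos[of k] by auto
  qed (use that in auto)
  show "0 < (\<Sum>k\<le>d. \<alpha> k)"
    by (rule sum_pos) (use pos in auto)
  show "(\<Sum>k\<le>d. \<alpha> k) < pi"
    using total pos[of "d + 1"] by simp
qed

lemma right_cone_linear:
  assumes "\<alpha> \<in> angle_tuples d"
  shows "z \<in> cone \<alpha> 0 \<longleftrightarrow> Im z \<ge> 0 \<and> Im z * cos (\<alpha> 0) < Re z * sin (\<alpha> 0)"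
proof (cases "z = 0 \<or> Im z < 0")
  case True
  then show ?thesis by (auto simp: cone_def closed_upper_half_def)
next
  case False
  have "0 \<le> Arg z"
    using False by (intro Arg_nonneg) auto
  then show ?thesis
    using False Arg_compare_linear(1)[of z "\<alpha> 0"] angle_partial_sums[OF assms]
    by (auto simp: cone_def sector_def closed_upper_half_def)
qed

lemma left_cone_linear:
  assumes "\<alpha> \<in> angle_tuples d" "d \<ge> 1"
  shows "z \<in> cone \<alpha> (d + 1) \<longleftrightarrow>
    Im z \<ge> 0 \<and> Re z * sin (\<Sum>k\<le>d. \<alpha> k) < Im z * cos (\<Sum>k\<le>d. \<alpha> k)"
proof (cases "z = 0 \<or> Im z < 0")
  case True
  then show ?thesis using assms(2) by (auto simp: cone_def closed_upper_half_def)
next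
  case False
  have "Arg z \<le> (\<Sum>j\<le>d + 1. \<alpha> j)"
    using assms Arg_bounded by (auto simp: angle_tuples_def)
  moreover have "{..<d + 1} = {..d}" by auto
  ultimately show ?thesis
    using False Arg_compare_linear(2)[of z "\<Sum>k\<le>d. \<alpha> k"] angle_partial_sums[OF assms(1)] assms(2)
    by (auto simp: cone_def sector_def closed_upper_half_def)
qed

lemma right_cone_translate:
  assumes "\<alpha> \<in> angle_tuples d" "z \<in> cone \<alpha> 0" "t \<ge> 0"
  shows "z + complex_of_real t \<in> cone \<alpha> 0"
proof -
  have "t * sin (\<alpha> 0) \<ge> 0"
    using assms(3) sin_gt_zero angle_partial_sums(1,2)[OF assms(1)] by (simp add: less_imp_le)
  then show ?thesis
    using assms(2) by (auto simp: right_cone_linear[OF assms(1)] algebra_simps)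
qed

lemma left_cone_translate:
  assumes "\<alpha> \<in> angle_tuples d" "d \<ge> 1" "z \<in> cone \<alpha> (d + 1)" "t \<ge> 0"
  shows "z - complex_of_real t \<in> cone \<alpha> (d + 1)"
proof -
  have "t * sin (\<Sum>k\<le>d. \<alpha> k) \<ge> 0"
    using assms(4) sin_gt_zero angle_partial_sums(4,5)[OF assms(1)] by (simp add: less_imp_le)
  then show ?thesis
    using assms(3) by (auto simp: left_cone_linear[OF assms(1,2), simplified] algebra_simps)
qed

lemma middle_cone_Arg:
  assumes "\<alpha> \<in> angle_tuples d" "z \<in> middle_cone d \<alpha>" "z \<noteq> 0"
  shows "\<alpha> 0 \<le> Arg z" and "Arg z \<le> (\<Sum>k\<le>d. \<alpha> k)"
proof -
  obtain j where j: "1 \<le> j" "j \<le> d" "z \<in> cone \<alpha> j"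
    using assms(2) by (auto simp: middle_cone_def)
  have arg: "Arg z \<in> sector \<alpha> j" using j assms(3) by (auto simp: cone_def split: if_splits)
  have bounds: "\<alpha> 0 \<le> Arg z \<and> Arg z \<le> (\<Sum>k\<le>j. \<alpha> k)"
  proof (cases "j = 1")
    case True
    then show ?thesis using arg by (auto simp: sector_def)
  next
    case False
    then obtain i where i: "j = Suc i" using j by (cases j) auto
    have "\<alpha> 0 \<le> (\<Sum>k\<le>i. \<alpha> k)"
      using angle_partial_sums(3)[OF assms(1), of 0 i] i j by simp
    then show ?thesis using arg False j by (auto simp: sector_def i lessThan_Suc_atMost)
  qed
  then show "\<alpha> 0 \<le> Arg z" by simp
  show "Arg z \<le> (\<Sum>k\<le>d. \<alpha> k)"
    using bounds angle_partial_sums(3)[OF assms(1), of j d] j by simp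
qed

lemma cones_disjoint:
  assumes "\<alpha> \<in> angle_tuples d" "d \<ge> 1"
  shows "cone \<alpha> (d + 1) \<inter> middle_cone d \<alpha> = {}"
    and "cone \<alpha> 0 \<inter> middle_cone d \<alpha> = {}"
    and "cone \<alpha> (d + 1) \<inter> cone \<alpha> 0 = {}"
proof -
  have left: "Arg z > (\<Sum>k\<le>d. \<alpha> k) \<and> z \<noteq> 0" if "z \<in> cone \<alpha> (d + 1)" for z
  proof -
    have "{..<Suc d} = {..d}" by auto
    then show ?thesis using that assms(2) by (auto simp: cone_def sector_def)
  qed
  have right: "Arg z < \<alpha> 0 \<and> z \<noteq> 0" if "z \<in> cone \<alpha> 0" for z
    using that by (auto simp: cone_def sector_def)
  have le: "\<alpha> 0 \<le> (\<Sum>k\<le>d. \<alpha> k)"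
    using angle_partial_sums(3)[OF assms(1), of 0 d] by simp
  show "cone \<alpha> (d + 1) \<inter> middle_cone d \<alpha> = {}"
    using left middle_cone_Arg(2)[OF assms(1)] by (fastforce simp: not_le[symmetric])
  show "cone \<alpha> 0 \<inter> middle_cone d \<alpha> = {}"
    using right middle_cone_Arg(1)[OF assms(1)] by (fastforce simp: not_le[symmetric])
  show "cone \<alpha> (d + 1) \<inter> cone \<alpha> 0 = {}"
    using left right le by (force simp: not_le[symmetric])
qed

section \<open>Lattice paths in a unimodular box\<close>

lemma unimodular_coordinates:
  fixes a b c e x y :: int
  assumes "\<bar>a * e - b * c\<bar> = 1"
  shows "\<exists>i j. x = i * a + j * c \<and> y = i * b + j * e"
proof -
  define s where "s = a * e - b * c"
  have "s = 1 \<or> s = - 1" using assms unfolding s_def by linarith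
  then have ss: "s * s = 1" by auto
  \<comment> \<open>Cramer's rule; division by \<open>s = \<plusminus>1\<close> is multiplication by \<open>s\<close>.\<close>
  have "x = s * (x * e - y * c) * a + s * (a * y - b * x) * c"
  proof -
    have "s * (x * e - y * c) * a + s * (a * y - b * x) * c = (s * s) * x"
      by (simp add: s_def algebra_simps)
    then show ?thesis using ss by simp
  qed
  moreover have "y = s * (x * e - y * c) * b + s * (a * y - b * x) * e"
  proof -
    have "s * (x * e - y * c) * b + s * (a * y - b * x) * e = (s * s) * y"
      by (simp add: s_def algebra_simps)
    then show ?thesis using ss by simp
  qed
  ultimately show ?thesis by blast
qed

text \<open>A weak form of the law of best approximation: among the lattice points of the box spanned by a
  unimodular pair \<open>u = (a, b)\<close>, \<open>v = (c, e)\<close> whose errors do not have the same sign, no error lies strictly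
  between those of \<open>v\<close> and \<open>u\<close>, apart from the two corners \<open>0\<close> and \<open>u + v\<close>.\<close>

lemma box_point_outside:
  fixes a b c e Q P :: nat and lam :: real
  assumes det: "\<bar>int a * int e - int b * int c\<bar> = 1"
    and pos: "0 \<le> a * lam - b" and neg: "c * lam - e \<le> 0"
    and box: "Q \<le> a + c" "P \<le> b + e"
    and corners: "(Q, P) \<noteq> (0, 0)" "(Q, P) \<noteq> (a + c, b + e)"
  shows "a * lam - b \<le> Q * lam - P \<or> Q * lam - P \<le> c * lam - e"
proof -
  obtain i j where Q: "int Q = i * int a + j * int c" and P: "int P = i * int b + j * int e"
    using unimodular_coordinates[OF det] by metis
  have Qr: "real Q = i * a + j * c" and Pr: "real P = i * b + j * e"
    using arg_cong[OF Q, of real_of_int] arg_cong[OF P, of real_of_int] by auto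
  have err: "Q * lam - P = i * (a * lam - b) + j * (c * lam - e)"
    unfolding Qr Pr by (simp add: algebra_simps)
  consider "i \<ge> 1" "j \<le> 0" | "i \<le> 0" "j \<ge> 1" | "i \<ge> 1" "j \<ge> 1" | "i \<le> 0" "j \<le> 0"
    by linarith
  then show ?thesis
  proof cases
    case 1
    have "real_of_int j * (c * lam - e) \<ge> 0"
      using 1 neg by (intro mult_nonpos_nonpos) auto
    moreover have "1 * (a * lam - b) \<le> i * (a * lam - b)"
      using 1 pos by (intro mult_right_mono) auto
    ultimately show ?thesis unfolding err by argo
  next
    case 2
    have "real_of_int i * (a * lam - b) \<le> 0"
      using 2 pos by (intro mult_nonpos_nonneg) auto
    moreover have "j * (c * lam - e) \<le> 1 * (c * lam - e)"
      using 2 neg by (intro mult_right_mono_neg) auto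
    ultimately show ?thesis unfolding err by argo
  next
    case 3
    have "1 * int a + 1 * int c \<le> i * int a + j * int c"
         "1 * int b + 1 * int e \<le> i * int b + j * int e"
      using 3 by (intro add_mono mult_right_mono; simp)+
    then have "a + c \<le> Q" "b + e \<le> P"
      unfolding Q[symmetric] P[symmetric] by linarith+
    then show ?thesis using box corners by auto
  next
    case 4
    have "i * int a + j * int c \<le> 0" "i * int b + j * int e \<le> 0"
      using 4 by (intro add_nonpos_nonpos mult_nonpos_nonneg; simp)+
    then have "Q = 0" "P = 0" unfolding Q[symmetric] P[symmetric] by linarith+
    then show ?thesis using corners by auto
  qed
qed

text \<open>The dynamical core, for an arbitrary splitting of a horizontal corridor into a left part \<open>L\<close>, a
  middle part \<open>M\<close> and a right part \<open>R\<close>. The iterate \<open>F ^^ s\<close> is followed up to the step at which the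
  lattice path from \<open>(q, p)\<close> reaches \<open>(a + c, b + e)\<close>.\<close>

lemma corridor_walk:
  fixes F :: "complex \<Rightarrow> complex" and L M R :: "complex set" and w :: complex and lam :: real
    and a b c e q p :: nat
  assumes left_closed: "\<And>x t. x \<in> L \<Longrightarrow> t \<ge> 0 \<Longrightarrow> x - complex_of_real t \<in> L"
    and right_closed: "\<And>x t. x \<in> R \<Longrightarrow> t \<ge> 0 \<Longrightarrow> x + complex_of_real t \<in> R"
    and disj: "L \<inter> M = {}" "R \<inter> M = {}"
    and F_left: "\<And>x. x \<in> L \<Longrightarrow> F x = x + complex_of_real lam"
    and F_right: "\<And>x. x \<in> R \<Longrightarrow> F x = x - 1"
    and lam: "0 \<le> lam"
    and det: "\<bar>int a * int e - int b * int c\<bar> = 1"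
    and w: "w \<in> M"
    and u: "w + complex_of_real (a * lam - b) \<in> R"
    and v: "w + complex_of_real (c * lam - e) \<in> L"
    and uv: "w + complex_of_real ((a + c) * lam - (b + e)) \<in> M"
    and start: "(q, p) \<noteq> (0, 0)" "q \<le> a + c" "p \<le> b + e"
  defines "N \<equiv> (a + c - q) + (b + e - p)"
  shows "(F ^^ N) (w + complex_of_real (q * lam - p)) = w + complex_of_real ((a + c) * lam - (b + e))"
    and "s < N \<Longrightarrow> (F ^^ s) (w + complex_of_real (q * lam - p)) \<notin> M"
proof -
  define pt where "pt Q P = w + complex_of_real (real Q * lam - real P)" for Q P :: nat
  have uv': "pt (a + c) (b + e) \<in> M" using uv by (simp add: pt_def)
  \<comment> \<open>The signs of the two errors follow from the position of \<open>w\<close> in the middle.\<close>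
  have pos: "0 \<le> a * lam - b"
  proof (rule ccontr)
    assume "\<not> ?thesis"
    then have "w + complex_of_real (a * lam - b) + complex_of_real (- (a * lam - b)) \<in> R"
      by (intro right_closed u) auto
    then show False using w disj(2) by auto
  qed
  have neg: "c * lam - e \<le> 0"
  proof (rule ccontr)
    assume "\<not> ?thesis"
    then have "w + complex_of_real (c * lam - e) - complex_of_real (c * lam - e) \<in> L"
      by (intro left_closed v) auto
    then show False using w disj(1) by auto
  qed
  have outside: "pt Q P \<in> R \<or> pt Q P \<in> L"
    if "q \<le> Q" "p \<le> P" "Q \<le> a + c" "P \<le> b + e" "(Q, P) \<noteq> (a + c, b + e)" for Q P
  proof -
    have "(Q, P) \<noteq> (0, 0)" using that start(1) by auto
    with box_point_outside[OF det pos neg that(3,4) _ that(5)]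
    consider "a * lam - b \<le> Q * lam - P" | "Q * lam - P \<le> c * lam - e" by blast
    then show ?thesis
    proof cases
      case 1
      then have "w + complex_of_real (a * lam - b)
          + complex_of_real ((Q * lam - P) - (a * lam - b)) \<in> R"
        by (intro right_closed u) auto
      then show ?thesis by (simp add: pt_def)
    next
      case 2
      then have "w + complex_of_real (c * lam - e)
          - complex_of_real ((c * lam - e) - (Q * lam - P)) \<in> L"
        by (intro left_closed v) auto
      then show ?thesis by (simp add: pt_def)
    qed
  qed
  have walk: "\<exists>Q P. q \<le> Q \<and> p \<le> P \<and> Q \<le> a + c \<and> P \<le> b + e \<and> Q + P = q + p + s
      \<and> (F ^^ s) (pt q p) = pt Q P" if "s \<le> N" for s
    using that
  proof (induction s)
    case 0
    then show ?case using start by auto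
  next
    case (Suc s)
    then obtain Q P where QP: "q \<le> Q" "p \<le> P" "Q \<le> a + c" "P \<le> b + e" "Q + P = q + p + s"
      and it: "(F ^^ s) (pt q p) = pt Q P" by auto
    have "s < N" using Suc.prems by simp
    then have ne: "(Q, P) \<noteq> (a + c, b + e)" using QP by (auto simp: N_def)
    from outside[OF QP(1-4) ne] show ?case
    proof
      assume inR: "pt Q P \<in> R"
      have "P < b + e"
      proof (rule ccontr)
        assume "\<not> ?thesis"
        then have P: "P = b + e" using QP by simp
        have "pt Q P + complex_of_real ((a + c - Q) * lam) \<in> R"
          using QP lam by (intro right_closed inR) auto
        also have "pt Q P + complex_of_real ((a + c - Q) * lam) = pt (a + c) (b + e)"
          using QP by (simp add: pt_def P of_nat_diff algebra_simps)
        finally show False using uv' disj(2) by auto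
      qed
      moreover have "F (pt Q P) = pt Q (Suc P)"
        using F_right[OF inR] by (simp add: pt_def)
      ultimately show ?thesis
        using QP it by (intro exI[of _ Q] exI[of _ "Suc P"]) auto
    next
      assume inL: "pt Q P \<in> L"
      have "Q < a + c"
      proof (rule ccontr)
        assume "\<not> ?thesis"
        then have Q: "Q = a + c" using QP by simp
        have "pt Q P - complex_of_real (b + e - P) \<in> L"
          using QP by (intro left_closed inL) auto
        also have "pt Q P - complex_of_real (b + e - P) = pt (a + c) (b + e)"
          using QP by (simp add: pt_def Q of_nat_diff algebra_simps)
        finally show False using uv' disj(1) by auto
      qed
      moreover have "F (pt Q P) = pt (Suc Q) P"
        using F_left[OF inL] by (simp add: pt_def algebra_simps)
      ultimately show ?thesis
        using QP it by (intro exI[of _ "Suc Q"] exI[of _ P]) auto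
    qed
  qed
  have start_pt: "w + complex_of_real (q * lam - p) = pt q p" by (simp add: pt_def)
  obtain Q P where QP: "q \<le> Q" "p \<le> P" "Q \<le> a + c" "P \<le> b + e" "Q + P = q + p + N"
      "(F ^^ N) (pt q p) = pt Q P"
    using walk[of N] by auto
  have "Q = a + c" "P = b + e" using QP start by (auto simp: N_def)
  then show "(F ^^ N) (w + complex_of_real (q * lam - p))
      = w + complex_of_real ((a + c) * lam - (b + e))"
    using QP unfolding start_pt by (simp add: pt_def)
  show "(F ^^ s) (w + complex_of_real (q * lam - p)) \<notin> M" if "s < N"
  proof -
    obtain Q P where QP: "q \<le> Q" "p \<le> P" "Q \<le> a + c" "P \<le> b + e" "Q + P = q + p + s"
        "(F ^^ s) (pt q p) = pt Q P"
      using walk[of s] \<open>s < N\<close> by auto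
    have "(Q, P) \<noteq> (a + c, b + e)" using QP \<open>s < N\<close> by (auto simp: N_def)
    from outside[OF QP(1-4) this] show ?thesis
      using QP(6) disj unfolding start_pt by auto
  qed
qed

section \<open>First return to the middle cone\<close>

text \<open>The walk above, run by the translated cone exchange after its first step \<open>E(z) - \<eta>\<close>, which
  accounts for the \<open>1\<close> added to the number of lattice steps.\<close>

lemma first_return_unimodular:
  fixes a b c e q p :: nat and lam \<eta> :: real
  assumes d: "d \<ge> 1" and \<alpha>: "\<alpha> \<in> angle_tuples d" and lam: "0 \<le> lam"
    and \<eta>: "\<eta> = real p - real q * lam"
    and w: "cone_exchange d \<alpha> \<tau> z \<in> middle_cone d \<alpha>"
    and det: "\<bar>int a * int e - int b * int c\<bar> = 1"
    and u: "cone_exchange d \<alpha> \<tau> z + complex_of_real (a * lam - b) \<in> cone \<alpha> 0"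
    and v: "cone_exchange d \<alpha> \<tau> z + complex_of_real (c * lam - e) \<in> cone \<alpha> (d + 1)"
    and uv: "cone_exchange d \<alpha> \<tau> z + complex_of_real ((a + c) * lam - (b + e)) \<in> middle_cone d \<alpha>"
    and start: "(q, p) \<noteq> (0, 0)" "q \<le> a + c" "p \<le> b + e"
  shows "return_time d \<alpha> \<tau> lam \<eta> 1 z = enat (Suc ((a + c - q) + (b + e - p)))"
    and "return_map d \<alpha> \<tau> lam \<eta> 1 z
      = cone_exchange d \<alpha> \<tau> z + complex_of_real ((a + c) * lam - (b + e))"
proof -
  define F where "F = tce d \<alpha> \<tau> lam \<eta> 1"
  define w where "w = cone_exchange d \<alpha> \<tau> z"
  define N where "N = (a + c - q) + (b + e - p)"
  note disj = cones_disjoint[OF \<alpha> d]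
  have F_left: "F x = x + complex_of_real lam" if "x \<in> cone \<alpha> (d + 1)" for x
  proof -
    have "x \<notin> middle_cone d \<alpha>" using that disj(1) by blast
    then show ?thesis using that
      by (simp add: F_def tce_def cone_exchange_def cone_translation_def)
  qed
  have F_right: "F x = x - 1" if "x \<in> cone \<alpha> 0" for x
  proof -
    have "x \<notin> middle_cone d \<alpha>" "x \<notin> cone \<alpha> (d + 1)" using that disj(2,3) by blast+
    then show ?thesis
      by (simp add: F_def tce_def cone_exchange_def cone_translation_def)
  qed
  have first: "F z = w + complex_of_real (q * lam - p)"
  proof -
    have "w \<in> middle_cone d \<alpha>" "w \<notin> cone \<alpha> (d + 1)"
      using w disj(1) by (auto simp: w_def)
    then show ?thesis
      by (simp add: F_def tce_def cone_translation_def w_def[symmetric] \<eta>)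
  qed
  note walk = corridor_walk[where L = "cone \<alpha> (d + 1)" and R = "cone \<alpha> 0" and M = "middle_cone d \<alpha>"
      and F = F and w = w, OF left_cone_translate[OF \<alpha> d] right_cone_translate[OF \<alpha>]
      disj(1,2) F_left F_right lam det w[folded w_def] u[folded w_def] v[folded w_def]
      uv[folded w_def] start, folded N_def first]
  have last: "(F ^^ Suc N) z = w + complex_of_real ((a + c) * lam - (b + e))"
    using walk(1) by (simp only: funpow_Suc_right o_apply)
  have before: "(F ^^ Suc s) z \<notin> middle_cone d \<alpha>" if "s < N" for s
    using walk(2)[of s] that by (simp only: funpow_Suc_right o_apply not_False_eq_True)
  have "Inf {enat n |n. n > 0 \<and> (F ^^ n) z \<in> middle_cone d \<alpha>} = enat (Suc N)"
  proof (rule antisym)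
    show "Inf {enat n |n. n > 0 \<and> (F ^^ n) z \<in> middle_cone d \<alpha>} \<le> enat (Suc N)"
      using last uv by (intro Inf_lower CollectI exI[of _ "Suc N"]) (simp only: w_def, simp)
    show "enat (Suc N) \<le> Inf {enat n |n. n > 0 \<and> (F ^^ n) z \<in> middle_cone d \<alpha>}"
    proof (rule Inf_greatest, clarify)
      fix n :: nat assume n: "n > 0" "(F ^^ n) z \<in> middle_cone d \<alpha>"
      then obtain s where "n = Suc s" by (cases n) auto
      then show "enat (Suc N) \<le> enat n" using before[of s] n by (cases "s < N") auto
    qed
  qed
  then show time: "return_time d \<alpha> \<tau> lam \<eta> 1 z = enat (Suc ((a + c - q) + (b + e - p)))"
    by (simp add: return_time_def F_def N_def)
  show "return_map d \<alpha> \<tau> lam \<eta> 1 z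
      = cone_exchange d \<alpha> \<tau> z + complex_of_real ((a + c) * lam - (b + e))"
    using last unfolding return_map_def time by (simp only: F_def N_def w_def the_enat.simps)
qed

section \<open>Convergents and the return sets\<close>

lemma convergents_det:
  fixes lam :: real
  shows
  "\<bar>int (cf_den lam (Suc m)) * int (cf_num lam m) - int (cf_num lam (Suc m)) * int (cf_den lam m)\<bar> = 1"
proof (induction m)
  case 0
  then show ?case by simp
next
  case (Suc m)
  have "int (cf_den lam (Suc (Suc m))) * int (cf_num lam (Suc m))
      - int (cf_num lam (Suc (Suc m))) * int (cf_den lam (Suc m))
    = - (int (cf_den lam (Suc m)) * int (cf_num lam m)
      - int (cf_num lam (Suc m)) * int (cf_den lam m))"
    by (simp add: algebra_simps)
  then show ?case using Suc by (simp only: abs_minus_cancel)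
qed

lemma semiconvergent_det:
  fixes lam :: real
  shows
  "\<bar>int (cf_den lam (m + 1)) * int (n * cf_num lam (m + 1) + cf_num lam m)
    - int (cf_num lam (m + 1)) * int (n * cf_den lam (m + 1) + cf_den lam m)\<bar> = 1"
  using convergents_det[of lam m] by (simp add: algebra_simps)

lemma mem_shift_iff: "z \<in> shift A x \<longleftrightarrow> z + complex_of_real x \<in> A"
proof
  assume "z + complex_of_real x \<in> A"
  then have "z + complex_of_real x - complex_of_real x \<in> shift A x"
    unfolding shift_def by (rule imageI)
  then show "z \<in> shift A x" by simp
qed (auto simp: shift_def)

lemma prev_err_eq:
  fixes lam :: real
  shows "prev_err lam m = cf_den lam m * lam - cf_num lam m"
  by (cases m) (auto simp: prev_err_def semi_err_def semi_den_def semi_num_def)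

lemma semi_fraction_mono:
  "semi_num lam m n \<le> semi_num lam m (n + 1)" "semi_den lam m n \<le> semi_den lam m (n + 1)"
  by (auto simp: semi_num_def semi_den_def)

theorem theorem4p5:
  fixes d p q m\<^sub>0 n\<^sub>0 :: nat
    and \<alpha> :: "nat \<Rightarrow> real" and \<tau> :: "nat \<Rightarrow> nat"
    and lam \<eta> :: real
  assumes "d \<ge> 1"
    and "\<alpha> \<in> angle_tuples d"
    and "bij_betw \<tau> {1..d} {1..d}"
    and "0 \<le> lam" and "lam < 1" and "lam \<notin> \<rat>"
    and "p \<noteq> 0" and "q \<noteq> 0"
    and "\<eta> = real p - real q * lam"
    and "- lam < \<eta>" and "\<eta> < 1"
    and "(m\<^sub>0, n\<^sub>0) \<in> index_set lam"
    and "semi_num lam m\<^sub>0 n\<^sub>0 < p \<or> semi_den lam m\<^sub>0 n\<^sub>0 < q"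
    and "\<forall>(m, n) \<in> index_set lam.
           semi_num lam m n < p \<or> semi_den lam m n < q
           \<longrightarrow> index_weight lam m n \<le> index_weight lam m\<^sub>0 n\<^sub>0"
  shows "\<forall>(m, n) \<in> index_set lam.
           index_weight lam m n > index_weight lam m\<^sub>0 n\<^sub>0 \<longrightarrow>
           (\<forall>z \<in> closed_upper_half. cone_exchange d \<alpha> \<tau> z \<in> return_set d \<alpha> lam m n \<longrightarrow>
              (\<exists>h. return_time d \<alpha> \<tau> lam \<eta> 1 z = enat h
                   \<and> int h = return_value lam p q m (n + 1))
              \<and> return_map d \<alpha> \<tau> lam \<eta> 1 z
                = cone_exchange d \<alpha> \<tau> z + complex_of_real (semi_err lam m (n + 1)))"
proof (clarify, goal_cases)
  case (1 m n z)
  define w where "w = cone_exchange d \<alpha> \<tau> z"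
  define Qu Pu where "Qu = cf_den lam (m + 1)" and "Pu = cf_num lam (m + 1)"
  define Qv Pv where "Qv = n * cf_den lam (m + 1) + cf_den lam m"
    and "Pv = n * cf_num lam (m + 1) + cf_num lam m"
  have sum: "semi_den lam m (n + 1) = Qu + Qv" "semi_num lam m (n + 1) = Pu + Pv"
    by (simp_all add: semi_den_def semi_num_def Qu_def Pu_def Qv_def Pv_def)
  have err: "semi_err lam m 0 = Qu * lam - Pu"
      "n * semi_err lam m 0 + prev_err lam m = Qv * lam - Pv"
      "semi_err lam m (n + 1) = (Qu + Qv) * lam - (Pu + Pv)"
    by (simp_all add: semi_err_def prev_err_eq semi_den_def semi_num_def
        Qu_def Pu_def Qv_def Pv_def algebra_simps)
  have det: "\<bar>int Qu * int Pv - int Pu * int Qv\<bar> = 1"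
    using semiconvergent_det by (simp only: Qu_def Pu_def Qv_def Pv_def)
  have det': "\<bar>int Qv * int Pu - int Pv * int Qu\<bar> = 1"
    using det by (simp add: abs_minus_commute mult.commute)
  \<comment> \<open>By maximality of \<open>(m\<^sub>0, n\<^sub>0)\<close> the convergent with index \<open>(m, n)\<close> already dominates \<open>(q, p)\<close>. The
    index \<open>(m, n + 1)\<close> may lie outside the index set, so it is reached from there by monotonicity.\<close>
  have le: "q \<le> Qu + Qv" "p \<le> Pu + Pv"
  proof -
    have "p \<le> semi_num lam m n \<and> q \<le> semi_den lam m n"
      using assms(14) 1(1,2) by (fastforce simp: not_le[symmetric])
    then show "q \<le> Qu + Qv" "p \<le> Pu + Pv"
      using semi_fraction_mono[where lam = lam and m = m and n = n] unfolding sum by linarith+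
  qed
  have mid: "w \<in> middle_cone d \<alpha>"
      "w + complex_of_real ((Qu + Qv) * lam - (Pu + Pv)) \<in> middle_cone d \<alpha>"
    using 1(4) unfolding w_def[symmetric] return_set_def mem_shift_iff err Int_iff
    by (auto simp: mem_shift_iff split: if_splits)
  have ret: "return_time d \<alpha> \<tau> lam \<eta> 1 z = enat (Suc ((Qu + Qv - q) + (Pu + Pv - p)))
      \<and> return_map d \<alpha> \<tau> lam \<eta> 1 z = w + complex_of_real ((Qu + Qv) * lam - (Pu + Pv))"
  proof (cases "even m")
    case True
    then have "w + complex_of_real (Qu * lam - Pu) \<in> cone \<alpha> 0"
        "w + complex_of_real (Qv * lam - Pv) \<in> cone \<alpha> (d + 1)"
      using 1(4) unfolding w_def[symmetric] return_set_def err(2) unfolding err(1,3) by (auto simp: mem_shift_iff)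
    then show ?thesis
      using first_return_unimodular[OF assms(1,2,4,9) _ det, of \<tau> z] mid le assms(7)
      unfolding w_def by simp
  next
    case False
    then have "w + complex_of_real (Qv * lam - Pv) \<in> cone \<alpha> 0"
        "w + complex_of_real (Qu * lam - Pu) \<in> cone \<alpha> (d + 1)"
      using 1(4) unfolding w_def[symmetric] return_set_def err(2) unfolding err(1,3) by (auto simp: mem_shift_iff)
    then show ?thesis
      using first_return_unimodular[OF assms(1,2,4,9) _ det', of \<tau> z] mid le assms(7)
      unfolding w_def by (simp add: add.commute)
  qed
  have "int (Suc ((Qu + Qv - q) + (Pu + Pv - p))) = return_value lam p q m (n + 1)"
    unfolding return_value_def sum using le by (simp add: of_nat_diff)
  then show ?case using ret unfolding err w_def by blast
qed

end
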